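(* Let $X$ be a Banach space, let $E \subset X$ be an arbitrary subset, let $f: E \to \mathbb{R}$ be a function and let $G: E \rightrightarrows X^*$ be a set-valued mapping such that $G(x)$ is a nonempty convex $w^*$-compact subset of $X^{*}$ for every $x\in E$. There exists a convex function $F: X \to \mathbb{R}$ that is bounded on bounded subsets of $X$ and such that $F(x)=f(x)$ and $\partial F(x)= G(x)$ for every $x\in E$ if and only if the following three conditions are all satisfied. $(C)$: $f(x) \geq f(y)+ y^* (x-y)$ for every $x,y\in E$ and every $y^*\in G(y)$. $(EX)$: If $(y_k)_k \subset E$ and $(y_k^* )_k \subset X^*$ are sequences such that $y_k^* \in G(y_k)$ for every $k$ and $\lim_k \|y_k^*\|_* =+\infty$, then $$\lim_k \frac{ y_k^*(y_k)-f(y_k)}{\|y_k^*\|_*}= +\infty.$$ $(CS)$: If $x\in E$ and $(y_k)_k \subset E$, $(y_k^* )_k \subset X^*$ are sequences such that $y_k^* \in G(y_k)$ for every $k$ and $(y_k^* )_k$ is bounded, then $$\lim_k \left( f(x)-f(y_k)-y_k^* (x-y_k ) \right)=0 \implies G(x) \cap \overline{\lbrace y_k^* \rbrace_k}^{w^*} \neq \emptyset.$$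
   Context: Banach spaces are real. $(X,\|\cdot\|)$ is a Banach space, $X^*$ its topological dual with dual norm $\|\cdot\|_*$, $w^*$ denotes the weak-star topology on $X^*$, and $\overline{\{y_k^*\}_k}^{w^*}$ is the $w^*$-closure of the set $\{y_k^* : k\in\mathbb{N}\}$. A set-valued mapping $G: E \rightrightarrows X^*$ assigns to each $x\in E$ a subset $G(x)\subset X^*$. For a convex function $F:X\to\mathbb{R}$, the subdifferential at $x$ is $\partial F(x)=\{\xi\in X^* : F(z)\ge F(x)+ \xi(z-x) \text{ for all } z\in X\}$. *)

theory Defs
  imports "HOL-Analysis.Analysis"
begin

text \<open>
  The dual of the Banach space \<open>'a\<close> is the type \<open>'a \<Rightarrow>\<^sub>L real\<close>, whose \<^const>\<open>norm\<close> is the dual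
  norm. For scalar-valued operators the library's strong operator topology (pointwise convergence)
  is by definition the initial topology of the evaluation maps, that is, the weak-star topology.
\<close>

abbreviation weak_star :: "('a::real_normed_vector \<Rightarrow>\<^sub>L real) topology" where
  "weak_star \<equiv> strong_operator_topology"

definition subdifferential :: "('a::real_normed_vector \<Rightarrow> real) \<Rightarrow> 'a \<Rightarrow> ('a \<Rightarrow>\<^sub>L real) set" where
  "subdifferential F x = {\<xi>. \<forall>z. F z \<ge> F x + blinfun_apply \<xi> (z - x)}"

definition bounded_on_bounded_sets :: "('a::real_normed_vector \<Rightarrow> real) \<Rightarrow> bool" where
  "bounded_on_bounded_sets F \<longleftrightarrow> (\<forall>B. bounded B \<longrightarrow> bounded (F ` B))"

text \<open>
  In the following conditions \<open>f\<close> and \<open>G\<close> are total functions standing for maps defined on \<open>E\<close>;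
  only their values on \<open>E\<close> are used.
\<close>

definition condition_C ::
    "'a::real_normed_vector set \<Rightarrow> ('a \<Rightarrow> real) \<Rightarrow> ('a \<Rightarrow> ('a \<Rightarrow>\<^sub>L real) set) \<Rightarrow> bool" where
  "condition_C E f G \<longleftrightarrow>
     (\<forall>x\<in>E. \<forall>y\<in>E. \<forall>\<eta>\<in>G y. f x \<ge> f y + blinfun_apply \<eta> (x - y))"

definition condition_EX ::
    "'a::real_normed_vector set \<Rightarrow> ('a \<Rightarrow> real) \<Rightarrow> ('a \<Rightarrow> ('a \<Rightarrow>\<^sub>L real) set) \<Rightarrow> bool" where
  "condition_EX E f G \<longleftrightarrow>
     (\<forall>(y :: nat \<Rightarrow> 'a) (\<eta> :: nat \<Rightarrow> 'a \<Rightarrow>\<^sub>L real).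
        (\<forall>k. y k \<in> E) \<longrightarrow> (\<forall>k. \<eta> k \<in> G (y k)) \<longrightarrow>
        filterlim (\<lambda>k. norm (\<eta> k)) at_top sequentially \<longrightarrow>
        filterlim (\<lambda>k. (blinfun_apply (\<eta> k) (y k) - f (y k)) / norm (\<eta> k)) at_top sequentially)"

definition condition_CS ::
    "'a::real_normed_vector set \<Rightarrow> ('a \<Rightarrow> real) \<Rightarrow> ('a \<Rightarrow> ('a \<Rightarrow>\<^sub>L real) set) \<Rightarrow> bool" where
  "condition_CS E f G \<longleftrightarrow>
     (\<forall>x\<in>E. \<forall>(y :: nat \<Rightarrow> 'a) (\<eta> :: nat \<Rightarrow> 'a \<Rightarrow>\<^sub>L real).
        (\<forall>k. y k \<in> E) \<longrightarrow> (\<forall>k. \<eta> k \<in> G (y k)) \<longrightarrow> bounded (range \<eta>) \<longrightarrow>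
        (\<lambda>k. f x - f (y k) - blinfun_apply (\<eta> k) (x - y k)) \<longlonglongrightarrow> 0 \<longrightarrow>
        G x \<inter> (weak_star closure_of (range \<eta>)) \<noteq> {})"

end

theory Submission
  imports Defs
begin

text \<open>
  For sufficiency take \<open>F\<close> to be the supremum of the affine functions \<open>x \<mapsto> f y + \<eta> (x - y)\<close> with
  \<open>y \<in> E\<close>, \<open>\<eta> \<in> G y\<close>. By (EX) the minorants that are not very negative on a given ball have
  uniformly bounded slopes, so \<open>F\<close> is bounded on bounded sets, and (C) gives \<open>F = f\<close> on \<open>E\<close>.
  If \<open>\<xi>\<close> is a subgradient at \<open>x\<close> outside \<open>G x\<close>, separate \<open>\<xi>\<close> from \<open>G x\<close> by a direction \<open>v\<close>: the minorants
  that are nearly maximal at \<open>x + t v\<close> for small \<open>t > 0\<close> have slopes \<open>\<eta>\<close> with \<open>\<eta> v\<close> bounded below by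
  nearly \<open>\<xi> v\<close>, and (CS) puts a point of the weak-star closure of such slopes into \<open>G x\<close>, a contradiction.
  For necessity of (CS), a weak-star cluster point of the \<open>y\<^sub>k\<^sup>*\<close> is a subgradient at \<open>x\<close>.
\<close>

section \<open>The weak-star topology\<close>

text \<open>The topology is the pullback of the product topology along \<open>blinfun_apply\<close>,
  so convergence can be tested coordinatewise, along any filter.\<close>

lemma limitin_weak_star_iff:
  "limitin weak_star \<eta> \<xi> H \<longleftrightarrow> (\<forall>z. ((\<lambda>k. blinfun_apply (\<eta> k) z) \<longlongrightarrow> blinfun_apply \<xi> z) H)"
proof
  assume lim: "limitin weak_star \<eta> \<xi> H"
  show "\<forall>z. ((\<lambda>k. blinfun_apply (\<eta> k) z) \<longlongrightarrow> blinfun_apply \<xi> z) H"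
    using continuous_map_limit[OF strong_operator_topology_continuous_evaluation lim]
    by (simp add: o_def)
next
  assume lim: "\<forall>z. ((\<lambda>k. blinfun_apply (\<eta> k) z) \<longlongrightarrow> blinfun_apply \<xi> z) H"
  have "limitin (product_topology (\<lambda>_. euclidean) UNIV) (\<lambda>k. blinfun_apply (\<eta> k)) (blinfun_apply \<xi>) H"
    using lim by (simp add: limitin_componentwise)
  then have *: "((\<lambda>k. blinfun_apply (\<eta> k)) \<longlongrightarrow> blinfun_apply \<xi>) H"
    by (simp add: euclidean_product_topology)
  show "limitin weak_star \<eta> \<xi> H"
    unfolding limitin_def strong_operator_topology_topspace
  proof (intro conjI allI impI UNIV_I)
    fix U :: "('a \<Rightarrow>\<^sub>L real) set"
    assume U: "openin weak_star U \<and> \<xi> \<in> U"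
    then obtain V where V: "open V" "U = blinfun_apply -` V"
      unfolding strong_operator_topology_def openin_pullback_topology by auto
    then show "\<forall>\<^sub>F k in H. \<eta> k \<in> U"
      using U topological_tendstoD[OF * V(1)] by simp
  qed
qed

text \<open>The Banach-Alaoglu theorem in the language of filters.\<close>

lemma bounded_weak_star_cluster:
  fixes \<eta> :: "'b \<Rightarrow> 'a::real_normed_vector \<Rightarrow>\<^sub>L real"
  assumes bdd: "bounded (range \<eta>)" and H: "H \<noteq> bot"
  obtains H' \<xi> where "H' \<noteq> bot" "H' \<le> H" "limitin weak_star \<eta> \<xi> H'"
proof -
  obtain M where M: "norm (\<eta> k) \<le> M" for k
    using bdd by (auto simp: bounded_iff)
  \<comment> \<open>A product of compact intervals, hence compact by Tychonoff; the norm bound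
    \<open>M\<close> keeps every evaluation map of \<open>\<eta> k\<close> inside it.\<close>
  define K where "K = PiE UNIV (\<lambda>z::'a. {- (M * norm z)..M * norm z})"
  define e where "e = (\<lambda>k. blinfun_apply (\<eta> k))"
  have "compactin (product_topology (\<lambda>_. euclidean) UNIV) K"
    unfolding K_def by (subst compactin_PiE) simp
  then have "compact K"
    by (simp add: euclidean_product_topology)
  have eK: "e k \<in> K" for k
  proof -
    have "\<bar>\<eta> k z\<bar> \<le> M * norm z" for z
      using norm_blinfun[of "\<eta> k" z] mult_right_mono[OF M, of "norm z" k] by simp
    then show ?thesis
      unfolding K_def e_def by (auto simp: abs_le_iff minus_le_iff)
  qed
  then have "\<exists>\<phi>\<in>K. inf (nhds \<phi>) (filtermap e H) \<noteq> bot"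
    using \<open>compact K\<close> H unfolding compact_filter by (simp add: filtermap_bot_iff eventually_filtermap)
  then obtain \<phi> where \<phi>: "\<phi> \<in> K" "inf (nhds \<phi>) (filtermap e H) \<noteq> bot"
    by blast
  \<comment> \<open>Pulling the neighbourhoods of the cluster point \<open>\<phi>\<close> back to
    the index set makes \<open>\<phi>\<close> a genuine limit along a filter finer than
    \<open>H\<close>.\<close>
  define H' where "H' = inf (filtercomap e (nhds \<phi>)) H"
  have "filtermap e H' \<noteq> bot"
  proof
    assume "filtermap e H' = bot"
    then have "eventually (\<lambda>_. False) H'"
      by (simp add: filtermap_bot_iff)
    then obtain P Q where PQ: "eventually P (nhds \<phi>)" "eventually Q H" "\<And>k. P (e k) \<Longrightarrow> Q k \<Longrightarrow> False"
      unfolding H'_def eventually_inf eventually_filtercomap by metis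
    then have "eventually (\<lambda>g. \<not> P g) (filtermap e H)"
      unfolding eventually_filtermap by (metis (mono_tags, lifting) eventually_mono)
    then have "eventually (\<lambda>_. False) (inf (nhds \<phi>) (filtermap e H))"
      using PQ(1) unfolding eventually_inf by blast
    with \<phi>(2) show False
      by (simp add: trivial_limit_def)
  qed
  then have H': "H' \<noteq> bot" "H' \<le> H"
    by (auto simp: H'_def filtermap_bot_iff)
  have "(e \<longlongrightarrow> \<phi>) H'"
    unfolding H'_def by (intro filterlim_mono[OF filterlim_filtercomap]) auto
  then have "limitin (product_topology (\<lambda>_. euclidean) UNIV) e \<phi> H'"
    by (simp add: euclidean_product_topology)
  then have lim: "((\<lambda>k. \<eta> k z) \<longlongrightarrow> \<phi> z) H'" for z
    by (simp add: limitin_componentwise e_def)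
  have "bounded_linear \<phi>"
  proof (rule bounded_linear_intro)
    fix x y :: 'a and r :: real
    show "\<phi> (x + y) = \<phi> x + \<phi> y"
      using tendsto_unique[OF H'(1) lim[of "x + y"]] tendsto_add[OF lim[of x] lim[of y]]
      by (simp add: blinfun.add_right)
    show "\<phi> (r *\<^sub>R x) = r *\<^sub>R \<phi> x"
      using tendsto_unique[OF H'(1) lim[of "r *\<^sub>R x"]] tendsto_scaleR[OF tendsto_const lim[of x]]
      by (simp add: blinfun.scaleR_right)
    have "\<phi> x \<in> {- (M * norm x)..M * norm x}"
      using \<phi>(1) unfolding K_def by (rule PiE_mem) simp
    then show "norm (\<phi> x) \<le> norm x * M"
      by (simp add: abs_le_iff mult.commute)
  qed
  then have "limitin weak_star \<eta> (Blinfun \<phi>) H'"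
    unfolding limitin_weak_star_iff using lim by (simp add: bounded_linear_Blinfun_apply)
  with H' that show thesis
    by blast
qed

text \<open>
  By compactness finitely many evaluations \<open>v\<^sub>i\<close> distinguish \<open>\<xi>\<close> from all points of \<open>K\<close>; the separating
  direction is the gradient of the finite-dimensional squared distance \<open>\<Sum>\<^sub>i (\<xi> v\<^sub>i - \<eta> v\<^sub>i)\<^sup>2\<close> at its
  minimiser over \<open>K\<close>.
\<close>

lemma weak_star_compact_convex_separation:
  fixes K :: "('a::real_normed_vector \<Rightarrow>\<^sub>L real) set"
  assumes K: "compactin weak_star K" "convex K" "K \<noteq> {}" and \<xi>: "\<xi> \<notin> K"
  obtains v s where "s < blinfun_apply \<xi> v" "\<And>\<eta>. \<eta> \<in> K \<Longrightarrow> blinfun_apply \<eta> v \<le> s"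
proof -
  define U where "U = (\<lambda>v. {\<eta>::'a \<Rightarrow>\<^sub>L real. \<eta> v \<in> - {\<xi> v}})"
  have "openin weak_star (U v)" for v
    using strong_operator_topology_basis[of "{v}" "\<lambda>_. - {\<xi> v}" "\<lambda>x. x"] by (simp add: U_def open_Compl)
  moreover have "K \<subseteq> \<Union> (range U)"
  proof
    fix \<eta> assume "\<eta> \<in> K"
    with \<xi> have "\<eta> \<noteq> \<xi>"
      by blast
    then obtain v where "\<eta> v \<noteq> \<xi> v"
      using blinfun_eqI by blast
    then show "\<eta> \<in> \<Union> (range U)"
      by (auto simp: U_def)
  qed
  ultimately obtain \<F> where "finite \<F>" "\<F> \<subseteq> range U" "K \<subseteq> \<Union> \<F>"
    using compactinD[OF K(1), of "range U"] by blast
  then obtain V where V: "finite V" "K \<subseteq> \<Union> (U ` V)"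
    by (metis finite_subset_image)
  define Q where "Q = (\<lambda>\<eta>::'a \<Rightarrow>\<^sub>L real. \<Sum>v\<in>V. (\<xi> v - \<eta> v)\<^sup>2)"
  have "continuous_map weak_star euclidean Q"
    unfolding Q_def
    by (intro continuous_intros V(1) strong_operator_topology_continuous_evaluation)
  then have "compact (Q ` K)"
    using image_compactin[OF K(1)] by fastforce
  then obtain \<zeta> where \<zeta>: "\<zeta> \<in> K" "\<And>\<eta>. \<eta> \<in> K \<Longrightarrow> Q \<zeta> \<le> Q \<eta>"
    using compact_attains_inf[of "Q ` K"] K(3) by auto
  define v where "v = (\<Sum>u\<in>V. (\<xi> u - \<zeta> u) *\<^sub>R u)"
  have app_v: "\<eta> v = (\<Sum>u\<in>V. (\<xi> u - \<zeta> u) * \<eta> u)" for \<eta> :: "'a \<Rightarrow>\<^sub>L real"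
    by (simp add: v_def blinfun.sum_right blinfun.scaleR_right)
  have "0 < Q \<zeta>"
  proof -
    obtain u where "u \<in> V" "\<zeta> u \<noteq> \<xi> u"
      using V(2) \<zeta>(1) by (auto simp: U_def)
    then show ?thesis
      unfolding Q_def using V(1) by (intro sum_pos2[of _ u]) auto
  qed
  \<comment> \<open>The coefficients of \<open>v\<close> are the residuals
    \<open>\<xi> u - \<zeta> u\<close>, so applying \<open>\<xi> - \<zeta>\<close> to
    \<open>v\<close> squares each of them.\<close>
  moreover have "\<xi> v - \<zeta> v = Q \<zeta>"
    by (simp add: app_v Q_def power2_eq_square algebra_simps flip: sum_subtractf)
  ultimately have "\<zeta> v < \<xi> v"
    by linarith
  moreover have "\<eta> v \<le> \<zeta> v" if \<eta>: "\<eta> \<in> K" for \<eta>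
  proof (rule ccontr)
    define D where "D = (\<Sum>u\<in>V. (\<eta> u - \<zeta> u)\<^sup>2)"
    define d where "d = \<eta> v - \<zeta> v"
    assume "\<not> \<eta> v \<le> \<zeta> v"
    then have "d > 0"
      by (simp add: d_def)
    have "D \<ge> 0"
      by (simp add: D_def sum_nonneg)
    \<comment> \<open>The cap 1 keeps the segment point in \<open>K\<close>. The other bound gives
      \<open>t * D \<le> d\<close>, so the quadratic term cannot offset the decrease
      \<open>2 * t * d\<close> of \<open>Q\<close>; the \<open>+ 1\<close> covers
      \<open>D = 0\<close>.\<close>
    define t where "t = min 1 (d / (D + 1))"
    have t: "0 < t" "t \<le> 1" "t \<le> d / (D + 1)"
      using \<open>d > 0\<close> \<open>D \<ge> 0\<close> by (auto simp: t_def)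
    have "(1 - t) *\<^sub>R \<zeta> + t *\<^sub>R \<eta> \<in> K"
      using convexD_alt[OF K(2) \<zeta>(1) \<eta>] t by simp
    then have "Q \<zeta> \<le> Q ((1 - t) *\<^sub>R \<zeta> + t *\<^sub>R \<eta>)"
      by (rule \<zeta>(2))
    also have "\<dots> = Q \<zeta> - 2 * t * d + t\<^sup>2 * D"
      unfolding Q_def D_def d_def app_v
      by (simp add: blinfun.add_left blinfun.diff_left blinfun.scaleR_left sum_distrib_left power2_eq_square
          algebra_simps flip: sum_subtractf sum.distrib)
    finally have "t * (2 * d) \<le> t * (t * D)"
      by (simp add: power2_eq_square algebra_simps)
    then have "2 * d \<le> t * D"
      using t(1) by simp
    also have "\<dots> \<le> t * (D + 1)"
      using t(1) by simp
    also have "\<dots> \<le> d"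
      using t(3) \<open>D \<ge> 0\<close> by (simp add: field_simps)
    finally show False
      using \<open>d > 0\<close> by simp
  qed
  ultimately show thesis
    using that by blast
qed

section \<open>Necessity\<close>

lemma condition_C_necessary:
  assumes "\<And>x. x \<in> E \<Longrightarrow> F x = f x" "\<And>x. x \<in> E \<Longrightarrow> subdifferential F x = G x"
  shows "condition_C E f G"
  unfolding condition_C_def
proof (intro ballI)
  fix x y \<eta> assume x: "x \<in> E" and y: "y \<in> E" and "\<eta> \<in> G y"
  then have "\<eta> \<in> subdifferential F y"
    using assms(2) by simp
  then show "f y + \<eta> (x - y) \<le> f x"
    unfolding subdifferential_def assms(1)[OF x, symmetric] assms(1)[OF y, symmetric] by simp
qed

text \<open>Test the subgradient inequality at a point \<open>z\<close> of a fixed ball where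
  \<open>\<eta> k z\<close> is comparable to the radius times the norm of \<open>\<eta> k\<close>.
  Since \<open>F z\<close> is bounded there, \<open>\<eta> k (y k) - f (y k)\<close> must grow at
  that rate.\<close>

lemma condition_EX_necessary:
  fixes F :: "'a::real_normed_vector \<Rightarrow> real"
  assumes bdd: "bounded_on_bounded_sets F"
    and F: "\<And>x. x \<in> E \<Longrightarrow> F x = f x" "\<And>x. x \<in> E \<Longrightarrow> subdifferential F x = G x"
  shows "condition_EX E f G"
  unfolding condition_EX_def
proof (intro allI impI)
  fix y :: "nat \<Rightarrow> 'a" and \<eta> :: "nat \<Rightarrow> 'a \<Rightarrow>\<^sub>L real"
  assume y: "\<forall>k. y k \<in> E" and \<eta>: "\<forall>k. \<eta> k \<in> G (y k)"
    and lim: "filterlim (\<lambda>k. norm (\<eta> k)) at_top sequentially"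
  show "filterlim (\<lambda>k. (\<eta> k (y k) - f (y k)) / norm (\<eta> k)) at_top sequentially"
    unfolding filterlim_at_top_ge[where c = 0]
  proof (intro allI impI)
    fix Z :: real assume "0 \<le> Z"
    \<comment> \<open>The factor 2 pays for a direction attaining only half the norm; the
      \<open>+ 1\<close> leaves one spare copy of the norm to absorb \<open>M\<close>.\<close>
    define R where "R = 2 * (Z + 1)"
    have "R > 0"
      using \<open>0 \<le> Z\<close> by (simp add: R_def)
    obtain M where M: "\<And>z. norm z \<le> R \<Longrightarrow> F z \<le> M"
      using bdd[unfolded bounded_on_bounded_sets_def, rule_format, of "cball 0 R"]
      by (force simp: bounded_iff abs_le_iff)
    have "\<forall>\<^sub>F k in sequentially. max 1 M \<le> norm (\<eta> k)"
      using lim unfolding filterlim_at_top by blast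
    then show "\<forall>\<^sub>F k in sequentially. Z \<le> (\<eta> k (y k) - f (y k)) / norm (\<eta> k)"
    proof eventually_elim
      case (elim k)
      then have pos: "norm (\<eta> k) > 0"
        by linarith
      have "\<exists>u. norm (\<eta> k) / 2 * norm u < norm (\<eta> k u)"
      proof (rule ccontr)
        assume "\<nexists>u. norm (\<eta> k) / 2 * norm u < norm (\<eta> k u)"
        then have "norm (\<eta> k) \<le> norm (\<eta> k) / 2"
          by (intro norm_blinfun_bound) (auto simp: not_less)
        with pos show False
          by simp
      qed
      then obtain u where u: "norm (\<eta> k) / 2 * norm u < \<bar>\<eta> k u\<bar>"
        by auto
      then have "u \<noteq> 0"
        by auto
      \<comment> \<open>Rescale \<open>u\<close> to length \<open>R\<close>, with the sign that
        makes \<open>\<eta> k z\<close> nonnegative.\<close>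
      define z where "z = (R * sgn (\<eta> k u) / norm u) *\<^sub>R u"
      have "norm z \<le> R"
        using \<open>R > 0\<close> \<open>u \<noteq> 0\<close> by (simp add: z_def abs_mult sgn_if)
      have "\<eta> k z = R * (\<bar>\<eta> k u\<bar> / norm u)"
        by (simp add: z_def blinfun.scaleR_right abs_sgn algebra_simps)
      moreover have "R * (norm (\<eta> k) / 2) \<le> R * (\<bar>\<eta> k u\<bar> / norm u)"
        using u \<open>R > 0\<close> \<open>u \<noteq> 0\<close> by (intro mult_left_mono) (auto simp: field_simps)
      moreover have "R * (norm (\<eta> k) / 2) = (Z + 1) * norm (\<eta> k)"
        by (simp add: R_def algebra_simps)
      ultimately have "(Z + 1) * norm (\<eta> k) \<le> \<eta> k z"
        by linarith
      moreover have "f (y k) + \<eta> k (z - y k) \<le> F z"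
      proof -
        have "\<eta> k \<in> subdifferential F (y k)"
          using F(2) y \<eta> by simp
        then show ?thesis
          using F(1)[of "y k"] y by (simp add: subdifferential_def)
      qed
      moreover have "F z \<le> M"
        by (rule M) fact
      ultimately have "Z * norm (\<eta> k) \<le> \<eta> k (y k) - f (y k)"
        using elim by (simp add: blinfun.diff_right algebra_simps)
      with pos show ?case
        by (simp add: field_simps)
    qed
  qed
qed

lemma condition_CS_necessary:
  fixes F :: "'a::real_normed_vector \<Rightarrow> real"
  assumes F: "\<And>x. x \<in> E \<Longrightarrow> F x = f x" "\<And>x. x \<in> E \<Longrightarrow> subdifferential F x = G x"
  shows "condition_CS E f G"
  unfolding condition_CS_def
proof (intro ballI allI impI)
  fix x and y :: "nat \<Rightarrow> 'a" and \<eta> :: "nat \<Rightarrow> 'a \<Rightarrow>\<^sub>L real"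
  assume x: "x \<in> E" and y: "\<forall>k. y k \<in> E" and \<eta>: "\<forall>k. \<eta> k \<in> G (y k)" and bdd: "bounded (range \<eta>)"
    and lim: "(\<lambda>k. f x - f (y k) - \<eta> k (x - y k)) \<longlonglongrightarrow> 0"
  obtain H \<xi> where H: "H \<noteq> bot" "H \<le> sequentially" and \<xi>: "limitin weak_star \<eta> \<xi> H"
    using bounded_weak_star_cluster[OF bdd sequentially_bot] by blast
  have "F x + \<xi> (z - x) \<le> F z" for z
  proof (rule tendsto_upperbound)
    have "((\<lambda>k. \<eta> k (z - x)) \<longlongrightarrow> \<xi> (z - x)) H"
      using \<xi> by (simp add: limitin_weak_star_iff)
    \<comment> \<open>This is \<open>f (y k) + \<eta> k (z - y k)\<close> regrouped around
      \<open>x\<close>: the gap in (CS) tends to 0 along \<open>H\<close> and only the evaluation at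
      \<open>z - x\<close> remains.\<close>
    then show "((\<lambda>k. F x - (f x - f (y k) - \<eta> k (x - y k)) + \<eta> k (z - x)) \<longlongrightarrow> F x + \<xi> (z - x)) H"
      using tendsto_add[OF tendsto_diff[OF tendsto_const[of "F x"] tendsto_mono[OF H(2) lim]]] by simp
    have "f (y k) + \<eta> k (z - y k) \<le> F z" for k
    proof -
      have "\<eta> k \<in> subdifferential F (y k)"
        using F(2) y \<eta> by simp
      then show ?thesis
        using F(1)[of "y k"] y by (simp add: subdifferential_def)
    qed
    then show "\<forall>\<^sub>F k in H. F x - (f x - f (y k) - \<eta> k (x - y k)) + \<eta> k (z - x) \<le> F z"
      using F(1)[OF x] by (simp add: blinfun.diff_right algebra_simps)
  qed (fact H(1))
  then have "\<xi> \<in> G x"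
    using F(2)[OF x] by (auto simp: subdifferential_def)
  moreover have "\<xi> \<in> weak_star closure_of range \<eta>"
  proof (rule limitin_closedin[OF \<xi> closedin_closure_of _ H(1)])
    show "\<forall>\<^sub>F k in H. \<eta> k \<in> weak_star closure_of range \<eta>"
      using closure_of_subset[of "range \<eta>" weak_star]
      by (intro always_eventually) (auto simp: strong_operator_topology_topspace)
  qed
  ultimately show "G x \<inter> weak_star closure_of range \<eta> \<noteq> {}"
    by blast
qed

section \<open>Sufficiency\<close>

text \<open>Turns the sequential condition into one threshold valid on all of \<open>E\<close>: a
  violating pair for every threshold would form a sequence contradicting (EX).\<close>

lemma condition_EX_uniform:
  assumes "condition_EX E f G"
  obtains M where "\<And>y \<eta>. y \<in> E \<Longrightarrow> \<eta> \<in> G y \<Longrightarrow> M \<le> norm \<eta> \<Longrightarrow> R * norm \<eta> \<le> blinfun_apply \<eta> y - f y"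
proof (rule ccontr)
  assume "\<not> thesis"
  \<comment> \<open>The threshold \<open>real k + 1\<close> also makes every norm positive,
    including at \<open>k = 0\<close>, so the quotient can be cleared.\<close>
  then have "\<forall>k::nat. \<exists>y \<eta>. y \<in> E \<and> \<eta> \<in> G y \<and> real k + 1 \<le> norm \<eta> \<and> \<eta> y - f y < R * norm \<eta>"
    using that by (metis not_less)
  then obtain y \<eta> where y: "\<And>k::nat. y k \<in> E" "\<And>k. \<eta> k \<in> G (y k)"
    and big: "\<And>k. real k + 1 \<le> norm (\<eta> k)" and less: "\<And>k. \<eta> k (y k) - f (y k) < R * norm (\<eta> k)"
    by metis
  have "filterlim (\<lambda>k. norm (\<eta> k)) at_top sequentially"
    by (rule filterlim_at_top_mono[OF filterlim_real_sequentially])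
       (use big in \<open>auto intro!: always_eventually order.trans[OF _ big]\<close>)
  then have "filterlim (\<lambda>k. (\<eta> k (y k) - f (y k)) / norm (\<eta> k)) at_top sequentially"
    using assms y unfolding condition_EX_def by blast
  then have "\<forall>\<^sub>F k in sequentially. R \<le> (\<eta> k (y k) - f (y k)) / norm (\<eta> k)"
    unfolding filterlim_at_top by blast
  then obtain k where k: "R \<le> (\<eta> k (y k) - f (y k)) / norm (\<eta> k)"
    by (auto dest: eventually_happens)
  have "norm (\<eta> k) > 0"
    using big[of k] by linarith
  with k less[of k] show False
    by (simp add: field_simps)
qed

text \<open>Use the threshold for \<open>R + 1\<close>: above it, \<open>R\<close> copies of the
  norm dominate \<open>\<eta> x\<close> and the remaining one pushes the value at \<open>x\<close>
  down to at most minus the norm of \<open>\<eta>\<close>.\<close>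

lemma affine_minorant_slope_bound:
  assumes "condition_EX E f G"
  obtains M where "\<And>x y \<eta> L. norm x \<le> R \<Longrightarrow> y \<in> E \<Longrightarrow> \<eta> \<in> G y \<Longrightarrow>
      L \<le> f y + blinfun_apply \<eta> (x - y) \<Longrightarrow> norm \<eta> \<le> max M (- L)"
proof -
  obtain M where M: "\<And>y \<eta>. y \<in> E \<Longrightarrow> \<eta> \<in> G y \<Longrightarrow> M \<le> norm \<eta> \<Longrightarrow> (R + 1) * norm \<eta> \<le> \<eta> y - f y"
    using condition_EX_uniform[OF assms] by blast
  have "norm \<eta> \<le> max M (- L)"
    if "norm x \<le> R" "y \<in> E" "\<eta> \<in> G y" "L \<le> f y + \<eta> (x - y)" for x y \<eta> L
  proof (rule ccontr)
    assume "\<not> norm \<eta> \<le> max M (- L)"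
    then have big: "M \<le> norm \<eta>" "- L < norm \<eta>"
      by auto
    have "\<eta> x \<le> norm \<eta> * R"
      using norm_blinfun[of \<eta> x] mult_left_mono[OF that(1), of "norm \<eta>"] by simp
    with M[OF that(2,3) big(1)] that(4) big(2) show False
      by (simp add: blinfun.diff_right algebra_simps)
  qed
  with that show thesis
    by blast
qed

text \<open>A minorant that is nonnegative at \<open>x\<close> has a controlled slope, and by (C)
  its value at \<open>x0\<close> is at most \<open>f x0\<close>; moving from \<open>x0\<close> to
  \<open>x\<close> then costs a bounded amount.\<close>

lemma affine_minorant_bound:
  assumes EX: "condition_EX E f G" and C: "condition_C E f G" and "x0 \<in> E"
  obtains B where "\<And>x y \<eta>. norm x \<le> R \<Longrightarrow> y \<in> E \<Longrightarrow> \<eta> \<in> G y \<Longrightarrow> f y + blinfun_apply \<eta> (x - y) \<le> B"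
proof -
  obtain M where M: "\<And>x y \<eta> L. norm x \<le> R \<Longrightarrow> y \<in> E \<Longrightarrow> \<eta> \<in> G y \<Longrightarrow>
      L \<le> f y + \<eta> (x - y) \<Longrightarrow> norm \<eta> \<le> max M (- L)"
    using affine_minorant_slope_bound[OF EX] by blast
  have "f y + \<eta> (x - y) \<le> max 0 (f x0 + max M 0 * (R + norm x0))"
    if "norm x \<le> R" "y \<in> E" "\<eta> \<in> G y" for x y \<eta>
  proof (cases "0 \<le> f y + \<eta> (x - y)")
    case True
    then have "norm \<eta> \<le> max M 0"
      using M[OF that, of 0] by simp
    moreover have "norm (x - x0) \<le> R + norm x0"
      using norm_triangle_ineq4[of x x0] that(1) by linarith
    ultimately have "norm \<eta> * norm (x - x0) \<le> max M 0 * (R + norm x0)"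
      by (intro mult_mono) auto
    then have "\<eta> (x - x0) \<le> max M 0 * (R + norm x0)"
      using norm_blinfun[of \<eta> "x - x0"] by simp
    moreover have "f y + \<eta> (x0 - y) \<le> f x0"
      using C \<open>x0 \<in> E\<close> that unfolding condition_C_def by blast
    ultimately show ?thesis
      by (simp add: blinfun.diff_right algebra_simps)
  qed simp
  with that show thesis
    by blast
qed

lemma convex_on_cSUP_affine:
  fixes c :: "'i \<Rightarrow> real" and \<eta> :: "'i \<Rightarrow> 'a::real_normed_vector \<Rightarrow>\<^sub>L real"
  assumes "I \<noteq> {}" and bdd: "\<And>x. bdd_above ((\<lambda>i. c i + \<eta> i x) ` I)"
  shows "convex_on UNIV (\<lambda>x. SUP i\<in>I. c i + \<eta> i x)"
proof (rule convex_onI)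
  fix t :: real and x y :: 'a
  assume t: "0 < t" "t < 1"
  let ?F = "\<lambda>x. SUP i\<in>I. c i + \<eta> i x"
  show "?F ((1 - t) *\<^sub>R x + t *\<^sub>R y) \<le> (1 - t) * ?F x + t * ?F y"
  proof (rule cSUP_least[OF \<open>I \<noteq> {}\<close>])
    fix i assume i: "i \<in> I"
    have "c i + \<eta> i ((1 - t) *\<^sub>R x + t *\<^sub>R y) = (1 - t) * (c i + \<eta> i x) + t * (c i + \<eta> i y)"
      by (simp add: blinfun.add_right blinfun.diff_right blinfun.scaleR_right algebra_simps)
    also have "\<dots> \<le> (1 - t) * ?F x + t * ?F y"
      using t by (intro add_mono mult_left_mono cSUP_upper[OF i bdd]) auto
    finally show "c i + \<eta> i ((1 - t) *\<^sub>R x + t *\<^sub>R y) \<le> (1 - t) * ?F x + t * ?F y" .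
  qed
qed simp

text \<open>The assumptions \<open>minorant\<close> and \<open>approx\<close> express that
  \<open>F\<close> is the pointwise supremum of the affine functions.\<close>

lemma subdifferential_subset_of_condition_CS:
  fixes F :: "'a::real_normed_vector \<Rightarrow> real"
  assumes x: "x \<in> E" and K: "G x \<noteq> {}" "convex (G x)" "compactin weak_star (G x)"
    and EX: "condition_EX E f G" and CS: "condition_CS E f G"
    and Fx: "F x = f x"
    and minorant: "\<And>z y \<eta>. y \<in> E \<Longrightarrow> \<eta> \<in> G y \<Longrightarrow> f y + blinfun_apply \<eta> (z - y) \<le> F z"
    and approx: "\<And>z \<epsilon>. 0 < \<epsilon> \<Longrightarrow> \<exists>y\<in>E. \<exists>\<eta>\<in>G y. F z - \<epsilon> < f y + blinfun_apply \<eta> (z - y)"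
  shows "subdifferential F x \<subseteq> G x"
proof
  fix \<xi> assume "\<xi> \<in> subdifferential F x"
  then have \<xi>: "F x + \<xi> (z - x) \<le> F z" for z
    by (simp add: subdifferential_def)
  show "\<xi> \<in> G x"
  proof (rule ccontr)
    assume "\<xi> \<notin> G x"
    then obtain v s where s: "s < \<xi> v" and G_le: "\<And>\<eta>. \<eta> \<in> G x \<Longrightarrow> \<eta> v \<le> s"
      using weak_star_compact_convex_separation[OF K(3,2,1)] by blast
    \<comment> \<open>Half the separation gap keeps \<open>\<xi> v - \<delta>\<close> strictly above
      \<open>s\<close>; the cap 1 keeps all \<open>x + t k *\<^sub>R v\<close> in one ball.\<close>
    define \<delta> where "\<delta> = min 1 ((\<xi> v - s) / 2)"
    have \<delta>: "0 < \<delta>" "\<delta> \<le> 1" "s < \<xi> v - \<delta>"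
      using s by (auto simp: \<delta>_def min_def field_simps)
    define t where "t = (\<lambda>k::nat. \<delta> * inverse (real (Suc k)))"
    have t_pos: "0 < t k" for k
      using \<delta> by (simp add: t_def)
    have t_le: "t k \<le> \<delta>" for k
      using \<delta> by (simp add: t_def field_simps)
    have t_lim: "t \<longlonglongrightarrow> 0"
      unfolding t_def using tendsto_mult[OF tendsto_const LIMSEQ_inverse_real_of_nat, of \<delta>] by simp
    \<comment> \<open>The error is the square of the step, so after division by \<open>t k\<close>
      it still tends to 0.\<close>
    have "\<exists>y \<eta>. y \<in> E \<and> \<eta> \<in> G y \<and> F (x + t k *\<^sub>R v) - (t k)\<^sup>2 < f y + \<eta> (x + t k *\<^sub>R v - y)" for k
      using approx[of "(t k)\<^sup>2" "x + t k *\<^sub>R v"] t_pos[of k] by auto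
    then obtain y \<eta> where y: "\<And>k. y k \<in> E" "\<And>k. \<eta> k \<in> G (y k)"
      and close: "\<And>k. F (x + t k *\<^sub>R v) - (t k)\<^sup>2 < f (y k) + \<eta> k (x + t k *\<^sub>R v - y k)"
      by metis
    have lower: "F x + t k * (\<xi> v - t k) \<le> f (y k) + \<eta> k (x - y k) + t k * \<eta> k v" for k
      using \<xi>[of "x + t k *\<^sub>R v"] close[of k]
      by (simp add: blinfun.scaleR_right blinfun.add_right blinfun.diff_right power2_eq_square
          algebra_simps)
    define R where "R = norm x + norm v"
    obtain M where M: "\<And>z y \<eta> L. norm z \<le> R \<Longrightarrow> y \<in> E \<Longrightarrow> \<eta> \<in> G y \<Longrightarrow>
        L \<le> f y + \<eta> (z - y) \<Longrightarrow> norm \<eta> \<le> max M (- L)"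
      using affine_minorant_slope_bound[OF EX] by blast
    define L where "L = F x - (\<bar>\<xi> v\<bar> + 1)"
    have norm_\<eta>: "norm (\<eta> k) \<le> max M (- L)" for k
    proof (rule M[OF _ y])
      have "norm (x + t k *\<^sub>R v) \<le> norm x + t k * norm v"
        using norm_triangle_ineq[of x "t k *\<^sub>R v"] t_pos[of k] by simp
      moreover have "t k * norm v \<le> 1 * norm v"
        using t_le[of k] \<delta>(2) by (intro mult_right_mono) auto
      ultimately show "norm (x + t k *\<^sub>R v) \<le> R"
        by (simp add: R_def)
      have "\<bar>t k * (\<xi> v - t k)\<bar> \<le> 1 * (\<bar>\<xi> v\<bar> + 1)"
        unfolding abs_mult using t_pos[of k] t_le[of k] \<delta>(2) by (intro mult_mono) auto
      then show "L \<le> f (y k) + \<eta> k (x + t k *\<^sub>R v - y k)"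
        using lower[of k] unfolding L_def
        by (simp add: blinfun.scaleR_right blinfun.add_right blinfun.diff_right)
    qed
    then have bdd: "bounded (range \<eta>)"
      by (auto simp: bounded_iff)
    have "(\<lambda>k. f x - f (y k) - \<eta> k (x - y k)) \<longlonglongrightarrow> 0"
    \<comment> \<open>The gap is nonnegative since minorants lie below \<open>F\<close> at
      \<open>x\<close>; by \<open>lower\<close> and the slope bound it is at most a constant times
      \<open>t k\<close> plus its square.\<close>
    proof (rule tendsto_sandwich[OF _ _ tendsto_const])
      show "\<forall>\<^sub>F k in sequentially. 0 \<le> f x - f (y k) - \<eta> k (x - y k)"
        using minorant[OF y, of _ x] Fx by (intro always_eventually allI) (simp add: algebra_simps)
      have "\<eta> k v \<le> max M (- L) * norm v" for k
        using norm_blinfun[of "\<eta> k" v] mult_right_mono[OF norm_\<eta>, of "norm v" k] by simp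
      then have "t k * \<eta> k v \<le> t k * (max M (- L) * norm v)" for k
        using t_pos[of k] by (intro mult_left_mono) auto
      then show "\<forall>\<^sub>F k in sequentially. f x - f (y k) - \<eta> k (x - y k)
          \<le> t k * (max M (- L) * norm v) - t k * (\<xi> v - t k)"
        using lower Fx by (intro always_eventually allI) (smt (verit))
      show "(\<lambda>k. t k * (max M (- L) * norm v) - t k * (\<xi> v - t k)) \<longlonglongrightarrow> 0"
        using t_lim by (auto intro!: tendsto_eq_intros)
    qed
    then have "G x \<inter> weak_star closure_of range \<eta> \<noteq> {}"
      using CS x y bdd unfolding condition_CS_def by blast
    then obtain \<zeta> where \<zeta>: "\<zeta> \<in> G x" "\<zeta> \<in> weak_star closure_of range \<eta>"
      by blast
    have \<eta>_ge: "\<xi> v - \<delta> \<le> \<eta> k v" for k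
    proof -
      \<comment> \<open>The minorant is at most \<open>F x\<close> at \<open>x\<close>, so nearly
        reaching \<open>F\<close> at the shifted point forces it to rise along \<open>v\<close>
        almost as fast as \<open>\<xi>\<close>.\<close>
      have "t k * (\<xi> v - t k) \<le> t k * \<eta> k v"
        using lower[of k] minorant[OF y, of _ x] by (smt (verit))
      then have "\<xi> v - t k \<le> \<eta> k v"
        using t_pos[of k] by simp
      with t_le[of k] show ?thesis
        by linarith
    qed
    have "closedin weak_star {\<theta>. \<xi> v - \<delta> \<le> blinfun_apply \<theta> v}"
      using closedin_continuous_map_preimage[OF strong_operator_topology_continuous_evaluation[of v],
          of "{\<xi> v - \<delta>..}"]
      by (simp add: strong_operator_topology_topspace)
    then have "weak_star closure_of range \<eta> \<subseteq> {\<theta>. \<xi> v - \<delta> \<le> blinfun_apply \<theta> v}"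
      using \<eta>_ge by (intro closure_of_minimal) auto
    with \<zeta> G_le[of \<zeta>] \<delta>(3) show False
      by force
  qed
qed

lemma convex_extension_exists:
  fixes f :: "'a::real_normed_vector \<Rightarrow> real"
  assumes G: "\<And>x. x \<in> E \<Longrightarrow> G x \<noteq> {}" "\<And>x. x \<in> E \<Longrightarrow> convex (G x)"
      "\<And>x. x \<in> E \<Longrightarrow> compactin weak_star (G x)"
    and C: "condition_C E f G" and EX: "condition_EX E f G" and CS: "condition_CS E f G"
  shows "\<exists>F. convex_on UNIV F \<and> bounded_on_bounded_sets F \<and>
            (\<forall>x\<in>E. F x = f x \<and> subdifferential F x = G x)"
proof (cases "E = {}")
  \<comment> \<open>There are no minorants to take a supremum of, so the zero function is
    used.\<close>
  case True
  then show ?thesis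
    by (intro exI[of _ "\<lambda>_. 0"]) (auto simp: convex_on_const bounded_on_bounded_sets_def bounded_iff)
next
  case False
  then obtain x0 \<eta>0 where x0: "x0 \<in> E" "\<eta>0 \<in> G x0"
    using G(1) by blast
  define P where "P = Sigma E G"
  \<comment> \<open>Written as a constant plus a linear term to match
    \<open>convex_on_cSUP_affine\<close>.\<close>
  define a where "a = (\<lambda>p z. f (fst p) - blinfun_apply (snd p) (fst p) + blinfun_apply (snd p) z)"
  define F where "F = (\<lambda>z. SUP p\<in>P. a p z)"
  have a_eq: "a (y, \<eta>) z = f y + \<eta> (z - y)" for y \<eta> z
    by (simp add: a_def blinfun.diff_right)
  have P_ne: "P \<noteq> {}"
    using x0 by (auto simp: P_def)
  have upper: "\<exists>B. \<forall>z. norm z \<le> R \<longrightarrow> (\<forall>p\<in>P. a p z \<le> B)" for R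
  proof -
    obtain B where "\<And>z y \<eta>. norm z \<le> R \<Longrightarrow> y \<in> E \<Longrightarrow> \<eta> \<in> G y \<Longrightarrow> f y + \<eta> (z - y) \<le> B"
      using affine_minorant_bound[OF EX C x0(1)] by blast
    then show ?thesis
      by (intro exI[of _ B]) (auto simp: P_def a_eq)
  qed
  have bdd: "bdd_above ((\<lambda>p. a p z) ` P)" for z
  proof -
    obtain B where "\<And>p. p \<in> P \<Longrightarrow> a p z \<le> B"
      using upper[of "norm z"] by blast
    then show ?thesis
      by (rule bdd_aboveI2)
  qed
  have minorant: "f y + \<eta> (z - y) \<le> F z" if "y \<in> E" "\<eta> \<in> G y" for y \<eta> z
    using cSUP_upper[OF _ bdd, of "(y, \<eta>)" z] that by (simp add: F_def P_def a_eq)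
  have approx: "\<exists>y\<in>E. \<exists>\<eta>\<in>G y. F z - \<epsilon> < f y + \<eta> (z - y)" if "0 < \<epsilon>" for z \<epsilon>
    using less_cSUP_iff[OF P_ne bdd, of "F z - \<epsilon>" z] that by (auto simp: F_def P_def a_eq)
  have F_eq: "F x = f x" if x: "x \<in> E" for x
  proof (rule antisym)
    show "F x \<le> f x"
      unfolding F_def using C that
      by (intro cSUP_least[OF P_ne]) (auto simp: P_def a_eq condition_C_def)
    obtain \<eta> where "\<eta> \<in> G x"
      using G(1)[OF x] by blast
    then show "f x \<le> F x"
      using minorant[of x \<eta> x] that by simp
  qed
  have "convex_on UNIV F"
    using convex_on_cSUP_affine[OF P_ne, of "\<lambda>p. f (fst p) - blinfun_apply (snd p) (fst p)" snd] bdd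
    by (simp add: F_def a_def)
  moreover have "bounded_on_bounded_sets F"
    unfolding bounded_on_bounded_sets_def
  proof (intro allI impI)
    fix S :: "'a set" assume "bounded S"
    then obtain R where R: "\<And>z. z \<in> S \<Longrightarrow> norm z \<le> R"
      by (auto simp: bounded_iff)
    obtain B where B: "\<And>z p. norm z \<le> R \<Longrightarrow> p \<in> P \<Longrightarrow> a p z \<le> B"
      using upper[of R] by blast
    \<comment> \<open>The single minorant given by \<open>x0\<close> and \<open>\<eta>0\<close>
      already bounds \<open>F\<close> from below on the ball.\<close>
    let ?A = "f x0 - norm \<eta>0 * (R + norm x0)"
    have "?A \<le> F z \<and> F z \<le> B" if "z \<in> S" for z
    proof
      have "norm (z - x0) \<le> R + norm x0"
        using norm_triangle_ineq4[of z x0] R[OF that] by linarith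
      then have "norm \<eta>0 * norm (z - x0) \<le> norm \<eta>0 * (R + norm x0)"
        by (intro mult_left_mono) auto
      then show "?A \<le> F z"
        using norm_blinfun[of \<eta>0 "z - x0"] minorant[OF x0, of z] by (simp add: abs_le_iff)
      show "F z \<le> B"
        unfolding F_def using B R[OF that] by (intro cSUP_least[OF P_ne]) auto
    qed
    then have "F ` S \<subseteq> {?A..B}"
      by auto
    then show "bounded (F ` S)"
      by (rule bounded_subset[OF bounded_closed_interval])
  qed
  moreover have "subdifferential F x = G x" if x: "x \<in> E" for x
  proof
    show "subdifferential F x \<subseteq> G x"
      using subdifferential_subset_of_condition_CS[OF x G(1-3)[OF x] EX CS F_eq[OF x] minorant approx] .
    show "G x \<subseteq> subdifferential F x"
      using minorant[OF x] F_eq[OF x] by (auto simp: subdifferential_def)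
  qed
  ultimately show ?thesis
    using F_eq by blast
qed

theorem theorem1p5:
  fixes E :: "'a::banach set"
    and f :: "'a \<Rightarrow> real"
    and G :: "'a \<Rightarrow> ('a \<Rightarrow>\<^sub>L real) set"
  assumes "\<And>x. x \<in> E \<Longrightarrow> G x \<noteq> {}"
    and "\<And>x. x \<in> E \<Longrightarrow> convex (G x)"
    and "\<And>x. x \<in> E \<Longrightarrow> compactin weak_star (G x)"
  shows "(\<exists>F :: 'a \<Rightarrow> real. convex_on UNIV F \<and> bounded_on_bounded_sets F \<and>
            (\<forall>x\<in>E. F x = f x \<and> subdifferential F x = G x)) \<longleftrightarrow>
         condition_C E f G \<and> condition_EX E f G \<and> condition_CS E f G"
proof
  assume "\<exists>F. convex_on UNIV F \<and> bounded_on_bounded_sets F \<and>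
            (\<forall>x\<in>E. F x = f x \<and> subdifferential F x = G x)"
  then obtain F where "bounded_on_bounded_sets F"
    and "\<And>x. x \<in> E \<Longrightarrow> F x = f x" "\<And>x. x \<in> E \<Longrightarrow> subdifferential F x = G x"
    by blast
  then show "condition_C E f G \<and> condition_EX E f G \<and> condition_CS E f G"
    by (intro conjI condition_C_necessary condition_EX_necessary condition_CS_necessary)
next
  assume "condition_C E f G \<and> condition_EX E f G \<and> condition_CS E f G"
  then show "\<exists>F. convex_on UNIV F \<and> bounded_on_bounded_sets F \<and>
            (\<forall>x\<in>E. F x = f x \<and> subdifferential F x = G x)"
    using convex_extension_exists[OF assms] by simp
qed

end
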